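(* Let $A$ be an arbitrary, possibly infinite, non-empty set. For any class $\mathcal{F}$ of operations on $A$, the following two conditions are equivalent: (i) $\mathcal{F}$ is locally closed, contains all projections, and is closed under permutation of variables, addition of dummy variables, and composition. (ii) $\mathcal{F}$ is characterized by a set $\mathcal{T}$ of clusters on $A$.
   Context: $\mathbb{N}$ is the set of nonnegative integers; $m\in\mathbb{N}$ is identified with $\{0,\dots,m-1\}$, and an $m$-tuple over $A$ is a map $m\to A$. An operation on $A$ is a map $f\colon A^n\to A$ with $n\ge1$; a class of operations is any set of operations on $A$; $\mathcal{F}^{(n)}$ is the set of $n$-ary members of $\mathcal{F}$. Projections are the operations $(x_1,\dots,x_n)\mapsto x_i$, $1\le i\le n$. For $n$-ary $f$ and $m$-ary $g$: $(\zeta f)(x_1,\dots,x_n)=f(x_2,\dots,x_n,x_1)$ and $(\tau f)(x_1,\dots,x_n)=f(x_2,x_1,x_3,\dots,x_n)$ if $n>1$, $\zeta f=\tau f=f$ if $n=1$; $(\nabla f)(x_1,\dots,x_{n+1})=f(x_2,\dots,x_{n+1})$; $(f\ast g)(x_1,\dots,x_{m+n-1})=f(g(x_1,\dots,x_m),x_{m+1},\dots,x_{m+n-1})$. Closure under permutation of variables means closure under $\zeta$ and $\tau$; under addition of dummy variables, closure under $\nabla$; under composition, closure under $\ast$. $\mathcal{F}$ is locally closed if for every $n\ge 1$ and every $g\colon A^n\to A$, we have $g\in\mathcal{F}$ whenever for every finite $F\subseteq A^n$ there is $f\in\mathcal{F}^{(n)}$ with $g|_F=f|_F$. A finite multiset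 $S$ on a set $X$ is a multiplicity function $\nu_S\colon X\to\mathbb{N}$ with $\sum_x\nu_S(x)<\infty$; $S'\subseteq S$ means $\nu_{S'}\le\nu_S$ pointwise; $\mathcal{M}(X)$ is the set of all finite multisets on $X$ (including the empty one). For an integer $m\ge1$, an $m$-ary cluster on $A$ is a subset $\Phi\subseteq\mathcal{M}(A^m)$ such that $S\in\Phi$ and $T\subseteq S$ imply $T\in\Phi$. An $m\times n$ matrix over $A$ is an $n$-tuple $\mathbf{M}=(\mathbf{a}^1,\dots,\mathbf{a}^n)$ of $m$-tuples over $A$ (its columns); the empty matrix has no columns. $\mathbf{M}^*$ is the multiset on $A^m$ of columns of $\mathbf{M}$, and $\mathbf{M}\prec\Phi$ means $\mathbf{M}^*\in\Phi$. $[\mathbf{M}_1|\mathbf{M}_2]$ denotes juxtaposition of columns. For $f\colon A^n\to A$ and an $m\times n$ matrix $\mathbf{M}$, $f\mathbf{M}$ is the $m$-tuple $i\mapsto f(\mathbf{a}^1(i),\dots,\mathbf{a}^n(i))$, regarded as a one-column matrix when juxtaposed. An $n$-ary operation $f$ on $A$ satisfies an $m$-ary cluster $\Phi$ if, whenever $\mathbf{M}=[\mathbf{M}_1|\mathbf{M}_2]\prec\Phi$ where $\mathbf{M}_1$ has $n$ columns and $\mathbf{M}_2$ may be empty, then $[f\mathbf{M}_1|\mathbf{M}_2]\prec\Phi$. $\mathcal{F}$ is characterized by a set $\mathcal{T}$ of clusters if $\mathcal{F}$ is precisely the class of operations on $A$ that satisfy every cluster in $\mathcal{T}$. *)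

theory Defs
  imports "HOL-Library.Multiset" "HOL-Library.FuncSet"
begin

text \<open>
  The base set is the universe of an arbitrary type \<open>'a\<close>. An \<open>m\<close>-tuple is a list of
  length \<open>m\<close>, and its components are indexed from 0 by \<open>!\<close>.
\<close>

definition tuples :: "nat \<Rightarrow> 'a list set" where
  "tuples m = {xs. length xs = m}"

text \<open>
  An operation is paired with its arity. The function is required to be \<open>undefined\<close>
  on lists whose length differs from the arity, so that equality of pairs is equality
  of operations; this is also why \<open>restrict\<close> occurs in the constructions below.
\<close>

type_synonym 'a oper = "nat \<times> ('a list \<Rightarrow> 'a)"

definition operations :: "'a oper set" where
  "operations = {(n, f). 1 \<le> n \<and> f \<in> extensional (tuples n)}"

definition proj :: "nat \<Rightarrow> nat \<Rightarrow> 'a oper" where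
  "proj n i = (n, restrict (\<lambda>xs. xs ! i) (tuples n))"

text \<open>For \<open>n = 1\<close>, both \<open>rotate1\<close> and \<open>swap2\<close> act as the identity on \<open>tuples n\<close>.\<close>

fun swap2 :: "'a list \<Rightarrow> 'a list" where
  "swap2 (x # y # zs) = y # x # zs"
| "swap2 xs = xs"

fun zeta_op :: "'a oper \<Rightarrow> 'a oper" where
  "zeta_op (n, f) = (n, restrict (\<lambda>xs. f (rotate1 xs)) (tuples n))"

fun tau_op :: "'a oper \<Rightarrow> 'a oper" where
  "tau_op (n, f) = (n, restrict (\<lambda>xs. f (swap2 xs)) (tuples n))"

fun nabla_op :: "'a oper \<Rightarrow> 'a oper" where
  "nabla_op (n, f) = (n + 1, restrict (\<lambda>xs. f (tl xs)) (tuples (n + 1)))"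

fun star_op :: "'a oper \<Rightarrow> 'a oper \<Rightarrow> 'a oper" where
  "star_op (n, f) (m, g) =
     (m + n - 1, restrict (\<lambda>xs. f (g (take m xs) # drop m xs)) (tuples (m + n - 1)))"

definition contains_projections :: "'a oper set \<Rightarrow> bool" where
  "contains_projections F \<longleftrightarrow> (\<forall>n\<ge>1. \<forall>i<n. proj n i \<in> F)"

definition closed_under_permutation :: "'a oper set \<Rightarrow> bool" where
  "closed_under_permutation F \<longleftrightarrow> (\<forall>f\<in>F. zeta_op f \<in> F \<and> tau_op f \<in> F)"

definition closed_under_dummies :: "'a oper set \<Rightarrow> bool" where
  "closed_under_dummies F \<longleftrightarrow> (\<forall>f\<in>F. nabla_op f \<in> F)"

definition closed_under_composition :: "'a oper set \<Rightarrow> bool" where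
  "closed_under_composition F \<longleftrightarrow> (\<forall>f\<in>F. \<forall>g\<in>F. star_op f g \<in> F)"

definition locally_closed :: "'a oper set \<Rightarrow> bool" where
  "locally_closed F \<longleftrightarrow>
     (\<forall>n g. (n, g) \<in> operations \<longrightarrow>
        (\<forall>X. finite X \<and> X \<subseteq> tuples n \<longrightarrow> (\<exists>f. (n, f) \<in> F \<and> (\<forall>x\<in>X. g x = f x))) \<longrightarrow>
        (n, g) \<in> F)"

text \<open>
  A cluster is paired with its arity. The library type of multisets contains exactly
  the finite ones.
\<close>

type_synonym 'a cluster = "nat \<times> 'a list multiset set"

definition clusters :: "'a cluster set" where
  "clusters = {(m, \<Phi>). 1 \<le> m \<and> (\<forall>S\<in>\<Phi>. set_mset S \<subseteq> tuples m) \<and>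
                       (\<forall>S T. S \<in> \<Phi> \<and> T \<subseteq># S \<longrightarrow> T \<in> \<Phi>)}"

text \<open>
  A matrix is the list of its columns, so that \<open>@\<close> is juxtaposition and \<open>mset\<close> yields
  the multiset of columns.
\<close>

definition matrices :: "nat \<Rightarrow> nat \<Rightarrow> 'a list list set" where
  "matrices m n = {M. length M = n \<and> set M \<subseteq> tuples m}"

definition apply_rows :: "nat \<Rightarrow> ('a list \<Rightarrow> 'a) \<Rightarrow> 'a list list \<Rightarrow> 'a list" where
  "apply_rows m f M = map (\<lambda>i. f (map (\<lambda>a. a ! i) M)) [0..<m]"

fun satisfies :: "'a oper \<Rightarrow> 'a cluster \<Rightarrow> bool" where
  "satisfies (n, f) (m, \<Phi>) \<longleftrightarrow>
     (\<forall>k. \<forall>M\<^sub>1\<in>matrices m n. \<forall>M\<^sub>2\<in>matrices m k.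
        mset (M\<^sub>1 @ M\<^sub>2) \<in> \<Phi> \<longrightarrow> mset ([apply_rows m f M\<^sub>1] @ M\<^sub>2) \<in> \<Phi>)"

definition characterized_by :: "'a oper set \<Rightarrow> 'a cluster set \<Rightarrow> bool" where
  "characterized_by F \<T> \<longleftrightarrow> F = {f \<in> operations. \<forall>\<Phi>\<in>\<T>. satisfies f \<Phi>}"

end

theory Submission
  imports Defs
begin

text \<open>
  That the operations satisfying given clusters form a class as in (i) is read off column
  by column: a dummy variable or a projection deletes columns of a matrix, which a cluster permits.

  Conversely, let \<open>g \<notin> F\<close>. Local closure yields finitely many tuples on which no member of \<open>F\<close>
  agrees with \<open>g\<close>; let \<open>M\<close> be the matrix with these tuples as rows. Call \<open>c\<close> reachable from a
  list \<open>L\<close> of columns if \<open>c = fL\<close> for some \<open>f \<in> F\<close>, and let \<open>\<Phi>\<close> consist of the multisets of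
  columns reachable simultaneously from pairwise disjoint parts of \<open>M\<^sup>*\<close>. Disjointness is what
  makes \<open>F\<close> satisfy \<open>\<Phi>\<close> although \<open>F\<close> need not be closed under identification of variables:
  applying \<open>f\<close> merges disjoint parts, and only a linear composition of members of \<open>F\<close> is needed.
  But \<open>g\<close> violates \<open>\<Phi>\<close>, since \<open>gM\<close> reachable from a part of \<open>M\<^sup>*\<close> would be \<open>fM\<close> for some \<open>f \<in> F\<close>.
\<close>

section \<open>Evaluating projections and the elementary constructions on matrices\<close>

lemma apply_rows_cong:
  "(\<And>i. i < m \<Longrightarrow> f (map (\<lambda>a. a ! i) M) = g (map (\<lambda>a. a ! i) N)) \<Longrightarrow>
     apply_rows m f M = apply_rows m g N"
  by (simp add: apply_rows_def)

lemma length_apply_rows [simp]: "length (apply_rows m f M) = m"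
  by (simp add: apply_rows_def)

lemma nth_apply_rows [simp]:
  "i < m \<Longrightarrow> apply_rows m f M ! i = f (map (\<lambda>a. a ! i) M)"
  by (simp add: apply_rows_def)

lemma map_swap2: "map h (swap2 xs) = swap2 (map h xs)"
  by (induction xs rule: swap2.induct) auto

lemma mset_rotate1 [simp]: "mset (rotate1 xs) = mset xs"
  by (cases xs) auto

lemma mset_swap2 [simp]: "mset (swap2 xs) = mset xs"
  by (induction xs rule: swap2.induct) auto

lemma length_swap2 [simp]: "length (swap2 xs) = length xs"
  by (induction xs rule: swap2.induct) auto

lemma set_swap2 [simp]: "set (swap2 xs) = set xs"
  by (induction xs rule: swap2.induct) auto

lemma apply_rows_proj:
  assumes "length M = n" "k < n" "set M \<subseteq> tuples m"
  shows "apply_rows m (snd (proj n k)) M = M ! k"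
proof (rule nth_equalityI)
  have "M ! k \<in> tuples m"
    using assms nth_mem by blast
  then show "length (apply_rows m (snd (proj n k)) M) = length (M ! k)"
    by (simp add: tuples_def)
qed (use assms in \<open>simp add: proj_def tuples_def\<close>)

lemma fst_op_simps [simp]:
  "fst (proj n k) = n" "fst (zeta_op f) = fst f" "fst (tau_op f) = fst f"
  "fst (nabla_op f) = fst f + 1" "fst (star_op f g) = fst g + fst f - 1"
  by (cases f; cases g; simp add: proj_def)+

text \<open>The length hypothesis puts every row of \<open>M\<close> into the domain of the
  \<open>restrict\<close> in \<open>zeta_op\<close>, off which the value is
  \<open>undefined\<close>. The next three lemmas work alike.\<close>

lemma apply_rows_zeta:
  "length M = fst f \<Longrightarrow> apply_rows m (snd (zeta_op f)) M = apply_rows m (snd f) (rotate1 M)"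
  by (cases f; rule apply_rows_cong) (simp add: tuples_def rotate1_map)

lemma apply_rows_tau:
  "length M = fst f \<Longrightarrow> apply_rows m (snd (tau_op f)) M = apply_rows m (snd f) (swap2 M)"
  by (cases f; rule apply_rows_cong) (simp add: tuples_def map_swap2)

lemma apply_rows_nabla:
  "length M = fst f + 1 \<Longrightarrow> apply_rows m (snd (nabla_op f)) M = apply_rows m (snd f) (tl M)"
  by (cases f; rule apply_rows_cong) (simp add: tuples_def map_tl)

lemma apply_rows_star:
  "length M = fst g + fst f - 1 \<Longrightarrow>
     apply_rows m (snd (star_op f g)) M =
       apply_rows m (snd f) (apply_rows m (snd g) (take (fst g) M) # drop (fst g) M)"
  by (cases f; cases g; rule apply_rows_cong) (simp add: tuples_def take_map drop_map)

lemma proj_operation: "i < n \<Longrightarrow> proj n i \<in> operations"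
  by (auto simp: operations_def proj_def)

lemma zeta_operation: "f \<in> operations \<Longrightarrow> zeta_op f \<in> operations"
  by (cases f) (auto simp: operations_def)

lemma tau_operation: "f \<in> operations \<Longrightarrow> tau_op f \<in> operations"
  by (cases f) (auto simp: operations_def)

lemma nabla_operation: "f \<in> operations \<Longrightarrow> nabla_op f \<in> operations"
  by (cases f) (auto simp: operations_def)

lemma star_operation: "f \<in> operations \<Longrightarrow> g \<in> operations \<Longrightarrow> star_op f g \<in> operations"
  by (cases f; cases g) (auto simp: operations_def)

section \<open>Closure properties of the operations that satisfy a cluster\<close>

lemma satisfiesI:
  assumes "\<And>M N. length M = fst f \<Longrightarrow> set M \<subseteq> tuples m \<Longrightarrow> set N \<subseteq> tuples m \<Longrightarrow>
             mset M + mset N \<in> \<Phi> \<Longrightarrow> add_mset (apply_rows m (snd f) M) (mset N) \<in> \<Phi>"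
  shows "satisfies f (m, \<Phi>)"
  using assms by (cases f) (auto simp: matrices_def)

lemma satisfiesD:
  assumes "satisfies f (m, \<Phi>)" "length M = fst f" "set M \<subseteq> tuples m" "set N \<subseteq> tuples m"
    and "mset M + mset N \<in> \<Phi>"
  shows "add_mset (apply_rows m (snd f) M) (mset N) \<in> \<Phi>"
  using assms by (cases f) (auto simp: matrices_def)

lemma cluster_subset:
  "(m, \<Phi>) \<in> clusters \<Longrightarrow> S \<in> \<Phi> \<Longrightarrow> T \<subseteq># S \<Longrightarrow> T \<in> \<Phi>"
  by (auto simp: clusters_def)

lemma satisfies_proj:
  assumes "(m, \<Phi>) \<in> clusters" "k < n"
  shows "satisfies (proj n k) (m, \<Phi>)"
proof (rule satisfiesI)
  fix M N :: "'a list list"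
  assume M: "length M = fst (proj n k :: 'a oper)" "set M \<subseteq> tuples m"
    and \<Phi>: "mset M + mset N \<in> \<Phi>"
  have len: "length M = n"
    using M by simp
  then have "{#M ! k#} \<subseteq># mset M"
    using assms(2) by simp
  then have "{#M ! k#} + mset N \<subseteq># mset M + mset N"
    by (rule subset_mset.add_right_mono)
  then show "add_mset (apply_rows m (snd (proj n k)) M) (mset N) \<in> \<Phi>"
    using cluster_subset[OF assms(1) \<Phi>] apply_rows_proj[OF len assms(2) M(2)] by simp
qed

lemma satisfies_zeta:
  "satisfies f (m, \<Phi>) \<Longrightarrow> satisfies (zeta_op f) (m, \<Phi>)"
  by (rule satisfiesI) (use satisfiesD[of f m \<Phi> "rotate1 _"] in \<open>simp add: apply_rows_zeta\<close>)

lemma satisfies_tau: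
  "satisfies f (m, \<Phi>) \<Longrightarrow> satisfies (tau_op f) (m, \<Phi>)"
  by (rule satisfiesI) (use satisfiesD[of f m \<Phi> "swap2 _"] in \<open>simp add: apply_rows_tau\<close>)

lemma satisfies_nabla:
  assumes "(m, \<Phi>) \<in> clusters" "satisfies f (m, \<Phi>)"
  shows "satisfies (nabla_op f) (m, \<Phi>)"
proof (rule satisfiesI)
  fix M N :: "'a list list"
  assume M: "length M = fst (nabla_op f)" "set M \<subseteq> tuples m" and N: "set N \<subseteq> tuples m"
    and \<Phi>: "mset M + mset N \<in> \<Phi>"
  then obtain a M' where M': "M = a # M'"
    by (cases M) auto
  have "mset M' + mset N \<in> \<Phi>"
    by (rule cluster_subset[OF assms(1) \<Phi>]) (simp add: M')
  then show "add_mset (apply_rows m (snd (nabla_op f)) M) (mset N) \<in> \<Phi>"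
    using satisfiesD[OF assms(2), of M' N] M N by (simp add: M' apply_rows_nabla)
qed

text \<open>The cluster is used twice: \<open>g\<close> acts first, while the other arguments of
  \<open>f\<close> wait among the untouched columns; then \<open>f\<close> acts on the result and
  these.\<close>

lemma satisfies_star:
  assumes f: "satisfies f (m, \<Phi>)" and g: "satisfies g (m, \<Phi>)" and pos: "1 \<le> fst f"
  shows "satisfies (star_op f g) (m, \<Phi>)"
proof (rule satisfiesI)
  fix M N :: "'a list list"
  assume M: "length M = fst (star_op f g)" "set M \<subseteq> tuples m" and N: "set N \<subseteq> tuples m"
    and \<Phi>: "mset M + mset N \<in> \<Phi>"
  define M\<^sub>1 M\<^sub>2 where "M\<^sub>1 = take (fst g) M" and "M\<^sub>2 = drop (fst g) M"
  \<comment> \<open>By \<open>pos\<close> the subtraction in the arity is not truncated: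
    \<open>M\<close> has at least \<open>fst g\<close> columns, and the rest are all arguments of
    \<open>f\<close> but the first.\<close>
  have M12: "M = M\<^sub>1 @ M\<^sub>2" "length M\<^sub>1 = fst g" "length M\<^sub>2 = fst f - 1"
    using M pos by (auto simp: M\<^sub>1_def M\<^sub>2_def)
  define c where "c = apply_rows m (snd g) M\<^sub>1"
  have "add_mset c (mset (M\<^sub>2 @ N)) \<in> \<Phi>"
    unfolding c_def by (rule satisfiesD[OF g]) (use M N \<Phi> M12 in \<open>auto simp: add.assoc\<close>)
  then have "add_mset (apply_rows m (snd f) (c # M\<^sub>2)) (mset N) \<in> \<Phi>"
    by (intro satisfiesD[OF f]) (use M N M12 pos in \<open>auto simp: c_def tuples_def\<close>)
  then show "add_mset (apply_rows m (snd (star_op f g)) M) (mset N) \<in> \<Phi>"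
    using M by (simp add: apply_rows_star c_def M\<^sub>1_def M\<^sub>2_def)
qed

text \<open>A matrix tests an operation only at its \<open>m\<close> rows, a finite set, so
  \<open>g\<close> may be replaced by an \<open>f\<close> chosen for that matrix.\<close>

lemma satisfies_locally:
  assumes "\<And>X. finite X \<Longrightarrow> X \<subseteq> tuples n \<Longrightarrow> \<exists>f. satisfies (n, f) (m, \<Phi>) \<and> (\<forall>x\<in>X. g x = f x)"
  shows "satisfies (n, g) (m, \<Phi>)"
proof (rule satisfiesI)
  fix M N :: "'a list list"
  assume M: "length M = fst (n, g)" "set M \<subseteq> tuples m" and N: "set N \<subseteq> tuples m"
    and \<Phi>: "mset M + mset N \<in> \<Phi>"
  define X where "X = (\<lambda>i. map (\<lambda>a. a ! i) M) ` {..<m}"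
  have "finite X" "X \<subseteq> tuples n"
    using M by (auto simp: X_def tuples_def)
  then obtain f where f: "satisfies (n, f) (m, \<Phi>)" "\<forall>x\<in>X. g x = f x"
    using assms by blast
  have "apply_rows m g M = apply_rows m f M"
    by (rule apply_rows_cong) (use f(2) in \<open>auto simp: X_def\<close>)
  then show "add_mset (apply_rows m (snd (n, g)) M) (mset N) \<in> \<Phi>"
    using satisfiesD[OF f(1)] M N \<Phi> by simp
qed

lemma characterized_imp_closed:
  assumes "\<T> \<subseteq> clusters" and "characterized_by F \<T>"
  shows "locally_closed F" "contains_projections F" "closed_under_permutation F"
    "closed_under_dummies F" "closed_under_composition F"
proof -
  have F: "f \<in> F \<longleftrightarrow> f \<in> operations \<and> (\<forall>m \<Phi>. (m, \<Phi>) \<in> \<T> \<longrightarrow> satisfies f (m, \<Phi>))" for f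
    using assms(2) by (auto simp: characterized_by_def)
  have \<T>: "(m, \<Phi>) \<in> clusters" if "(m, \<Phi>) \<in> \<T>" for m \<Phi>
    using assms(1) that by blast
  show "contains_projections F"
    unfolding contains_projections_def using F \<T> satisfies_proj proj_operation by blast
  show "closed_under_permutation F"
    unfolding closed_under_permutation_def
    using F satisfies_zeta satisfies_tau zeta_operation tau_operation by blast
  show "closed_under_dummies F"
    unfolding closed_under_dummies_def using F \<T> satisfies_nabla nabla_operation by blast
  have "1 \<le> fst f" if "f \<in> F" for f
    using that F[of f] by (auto simp: operations_def)
  then have "star_op f g \<in> F" if "f \<in> F" "g \<in> F" for f g
    using that by (simp add: F satisfies_star star_operation del: One_nat_def)
  then show "closed_under_composition F"
    by (simp add: closed_under_composition_def)
  show "locally_closed F"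
    unfolding locally_closed_def
  proof (intro allI impI)
    fix n g
    assume g: "(n, g) \<in> operations"
      and X: "\<forall>X. finite X \<and> X \<subseteq> tuples n \<longrightarrow> (\<exists>f. (n, f) \<in> F \<and> (\<forall>x\<in>X. g x = f x))"
    have "satisfies (n, g) (m, \<Phi>)" if \<Phi>: "(m, \<Phi>) \<in> \<T>" for m \<Phi>
    proof (rule satisfies_locally)
      fix Y :: "'a list set"
      assume "finite Y" "Y \<subseteq> tuples n"
      then obtain f where "(n, f) \<in> F" "\<forall>x\<in>Y. g x = f x"
        using X by blast
      then show "\<exists>f. satisfies (n, f) (m, \<Phi>) \<and> (\<forall>x\<in>Y. g x = f x)"
        using F \<Phi> by (intro exI[of _ f]) simp
    qed
    then show "(n, g) \<in> F"
      using F g by simp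
  qed
qed

section \<open>Reachability of a column from a list of columns\<close>

text \<open>Each entry of \<open>L\<close> fills exactly one argument place, so repeated columns
  count with multiplicity.\<close>

definition reachable :: "'a oper set \<Rightarrow> nat \<Rightarrow> 'a list list \<Rightarrow> 'a list \<Rightarrow> bool" where
  "reachable F m L c \<longleftrightarrow> (\<exists>f\<in>F. fst f = length L \<and> apply_rows m (snd f) L = c)"

lemma reachable_length: "reachable F m L c \<Longrightarrow> length c = m"
  by (auto simp: reachable_def)

lemma reachable_singleton:
  assumes "contains_projections F" "length c = m"
  shows "reachable F m [c] c"
proof -
  have "apply_rows m (snd (proj 1 0)) [c] = c"
    using apply_rows_proj[of "[c]" 1 0 m] assms(2) by (simp add: tuples_def)
  moreover have "proj 1 0 \<in> F"
    using assms(1) by (simp add: contains_projections_def)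
  ultimately show ?thesis
    unfolding reachable_def by (intro bexI[of _ "proj 1 0"]) auto
qed

lemma reachable_rotate1:
  assumes "closed_under_permutation F" "reachable F m (rotate1 L) c"
  shows "reachable F m L c"
proof -
  obtain f where f: "f \<in> F" "fst f = length L" "apply_rows m (snd f) (rotate1 L) = c"
    using assms(2) by (auto simp: reachable_def)
  have "zeta_op f \<in> F"
    using assms(1) f(1) by (simp add: closed_under_permutation_def)
  then show ?thesis
    unfolding reachable_def using f by (intro bexI[of _ "zeta_op f"]) (simp_all add: apply_rows_zeta)
qed

lemma reachable_swap2:
  assumes "closed_under_permutation F" "reachable F m (swap2 L) c"
  shows "reachable F m L c"
proof -
  obtain f where f: "f \<in> F" "fst f = length L" "apply_rows m (snd f) (swap2 L) = c"
    using assms(2) by (auto simp: reachable_def)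
  have "tau_op f \<in> F"
    using assms(1) f(1) by (simp add: closed_under_permutation_def)
  then show ?thesis
    unfolding reachable_def using f by (intro bexI[of _ "tau_op f"]) (simp_all add: apply_rows_tau)
qed

text \<open>Each rotation brings the last column to the front; one rotation per column of
  \<open>v\<close> exchanges the two blocks.\<close>

lemma reachable_append_commute:
  assumes "closed_under_permutation F" "reachable F m (u @ v) c"
  shows "reachable F m (v @ u) c"
  using assms(2)
proof (induction v arbitrary: u rule: rev_induct)
  case (snoc x v)
  then have "reachable F m (rotate1 ((x # u) @ v)) c"
    by simp
  then have "reachable F m ((x # u) @ v) c"
    by (rule reachable_rotate1[OF assms(1)])
  then have "reachable F m (v @ x # u) c"
    by (rule snoc.IH)
  then show ?case
    by simp
qed simp

text \<open>The swap of the first two arguments, conjugated by a cyclic shift, acts at any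
  position.\<close>

lemma reachable_transpose:
  assumes "closed_under_permutation F" "reachable F m (u @ x # y # v) c"
  shows "reachable F m (u @ y # x # v) c"
proof -
  have "reachable F m (swap2 ((y # x # v) @ u)) c"
    using reachable_append_commute[OF assms] by simp
  then have "reachable F m ((y # x # v) @ u) c"
    by (rule reachable_swap2[OF assms(1)])
  then show ?thesis
    by (rule reachable_append_commute[OF assms(1)])
qed

lemma reachable_move_front:
  assumes "closed_under_permutation F" "reachable F m (u @ p @ x # q) c"
  shows "reachable F m (u @ x # p @ q) c"
  using assms(2)
proof (induction p arbitrary: q rule: rev_induct)
  case (snoc y p)
  then have "reachable F m ((u @ p) @ x # y # q) c"
    using reachable_transpose[OF assms(1), of m "u @ p" y x q] by simp
  then show ?case
    using snoc.IH by simp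
qed simp

text \<open>Selection sort by \<open>reachable_move_front\<close>; the prefix \<open>u\<close> holds
  the columns already in place and makes the induction go through.\<close>

lemma reachable_permute:
  assumes perm: "closed_under_permutation F"
  shows "reachable F m (u @ L) c \<Longrightarrow> mset L = mset L' \<Longrightarrow> reachable F m (u @ L') c"
proof (induction L' arbitrary: u L)
  case (Cons x L')
  then have "x \<in> set L"
    by (metis list.set_intros(1) set_mset_mset)
  then obtain p q where L: "L = p @ x # q"
    by (meson split_list)
  have "reachable F m ((u @ [x]) @ p @ q) c"
    using reachable_move_front[OF perm] Cons.prems(1) by (simp add: L)
  then show ?case
    using Cons.IH[of "u @ [x]" "p @ q"] Cons.prems(2) by (simp add: L)
qed simp

lemma reachable_weaken:
  assumes dummies: "closed_under_dummies F" and "reachable F m L c"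
  shows "reachable F m (K @ L) c"
proof (induction K)
  case (Cons a K)
  then obtain f where f: "f \<in> F" "fst f = length (K @ L)" "apply_rows m (snd f) (K @ L) = c"
    by (auto simp: reachable_def)
  have "nabla_op f \<in> F"
    using dummies f(1) by (simp add: closed_under_dummies_def)
  then show ?case
    unfolding reachable_def using f by (intro bexI[of _ "nabla_op f"]) (simp_all add: apply_rows_nabla)
qed (use assms in simp)

text \<open>The surplus columns of \<open>M\<close> enter as dummy arguments in front, and a
  permutation restores the order.\<close>

lemma reachable_mset_mono:
  assumes "closed_under_permutation F" "closed_under_dummies F"
    and "reachable F m L c" "mset L \<subseteq># mset M"
  shows "reachable F m M c"
proof -
  obtain K where "mset M = mset L + mset K"
    using assms(4) ex_mset by (metis subset_mset.le_iff_add)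
  then show ?thesis
    using reachable_permute[OF assms(1), of m "[]" "K @ L" c M]
      reachable_weaken[OF assms(2,3), of K] by simp
qed

lemma reachable_compose_one:
  assumes "closed_under_composition F"
    and "reachable F m (c # es) d" "reachable F m N c"
  shows "reachable F m (N @ es) d"
proof -
  obtain f where f: "f \<in> F" "fst f = length es + 1" "apply_rows m (snd f) (c # es) = d"
    using assms(2) by (auto simp: reachable_def)
  obtain g where g: "g \<in> F" "fst g = length N" "apply_rows m (snd g) N = c"
    using assms(3) by (auto simp: reachable_def)
  have "star_op f g \<in> F"
    using assms(1) f(1) g(1) by (simp add: closed_under_composition_def)
  then show ?thesis
    unfolding reachable_def using f g
    by (intro bexI[of _ "star_op f g"]) (simp_all add: apply_rows_star)
qed

text \<open>Composition substitutes only for the first argument, so each finished block is rotated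
  to the end, into \<open>es\<close>, to expose the next argument. Blocks are concatenated and no
  variables are identified.\<close>

lemma reachable_compose:
  assumes "closed_under_permutation F" "closed_under_composition F"
    and "reachable F m (map fst ds @ es) d" "\<And>c N. (c, N) \<in> set ds \<Longrightarrow> reachable F m N c"
  shows "reachable F m (es @ concat (map snd ds)) d"
  using assms(3,4)
proof (induction ds arbitrary: es)
  case (Cons p ds)
  obtain c N where p: "p = (c, N)"
    by force
  have "reachable F m (N @ map fst ds @ es) d"
    using reachable_compose_one[OF assms(2)] Cons.prems by (simp add: p)
  then have "reachable F m (map fst ds @ es @ N) d"
    using reachable_append_commute[OF assms(1), of m N "map fst ds @ es"] by simp
  then show ?case
    using Cons.IH[of "es @ N"] Cons.prems(2) by (simp add: p)
qed simp

section \<open>The cluster of simultaneously reachable columns\<close>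

text \<open>
  In a member \<open>(c, L)\<close> of \<open>D\<close>, the list \<open>L\<close> is the part of \<open>M\<^sup>*\<close> used up by the column \<open>c\<close>.
\<close>

definition reachable_cluster :: "'a oper set \<Rightarrow> nat \<Rightarrow> 'a list list \<Rightarrow> 'a list multiset set" where
  "reachable_cluster F m M =
     {image_mset fst D | D. (\<forall>(c, L) \<in># D. reachable F m L c) \<and>
                            (\<Sum>p\<in>#D. mset (snd p)) \<subseteq># mset M}"

text \<open>Preimages are picked for the entries of \<open>xs\<close> one at a time. They form a
  list in the order of \<open>xs\<close>, because the columns of a matrix are ordered
  arguments.\<close>

lemma image_mset_eq_mset_plusE:
  assumes "image_mset h D = mset xs + B"
  obtains ds D' where "D = mset ds + D'" "map h ds = xs" "image_mset h D' = B"
  using assms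
proof (induction xs arbitrary: D thesis)
  case (Cons x xs)
  then obtain D\<^sub>1 a where D\<^sub>1: "D = add_mset a D\<^sub>1" "h a = x" "image_mset h D\<^sub>1 = mset xs + B"
    using msed_map_invR[of h D x "mset xs + B"] by auto
  obtain ds D' where "D\<^sub>1 = mset ds + D'" "map h ds = xs" "image_mset h D' = B"
    using Cons.IH[OF _ D\<^sub>1(3)] by blast
  then show ?case
    using Cons.prems(1)[of "a # ds" D'] D\<^sub>1 by simp
qed auto

text \<open>A submultiset of columns keeps the pairs lying over it; discarding the others only
  shrinks the total part of \<open>M\<close> in use.\<close>

lemma reachable_cluster_cluster:
  assumes "1 \<le> m"
  shows "(m, reachable_cluster F m M) \<in> clusters"
  unfolding clusters_def
proof (clarify, intro conjI ballI allI impI)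
  fix S
  assume "S \<in> reachable_cluster F m M"
  then show "set_mset S \<subseteq> tuples m"
    by (fastforce simp: reachable_cluster_def tuples_def dest: reachable_length)
next
  fix S T
  assume "S \<in> reachable_cluster F m M \<and> T \<subseteq># S"
  then obtain D where D: "S = image_mset fst D" "\<forall>(c, L) \<in># D. reachable F m L c"
      "(\<Sum>p\<in>#D. mset (snd p)) \<subseteq># mset M" and T: "T \<subseteq># S"
    by (auto simp: reachable_cluster_def)
  obtain ts B where ts: "T = mset ts" "S = mset ts + B"
    using T ex_mset by (metis subset_mset.le_iff_add)
  obtain ds D' where ds: "D = mset ds + D'" "map fst ds = ts"
    using image_mset_eq_mset_plusE ts(2) D(1) by metis
  have "T = image_mset fst (mset ds)"
    using ts(1) ds(2) by auto
  moreover have "(\<Sum>p\<in>#mset ds. mset (snd p)) \<subseteq># mset M"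
    using D(3) unfolding ds(1) image_mset_union sum_mset.union
    by (meson mset_subset_eq_add_left subset_mset.order_trans)
  moreover have "\<forall>(c, L) \<in># mset ds. reachable F m L c"
    using D(2) by (simp add: ds(1))
  ultimately show "T \<in> reachable_cluster F m M"
    unfolding reachable_cluster_def by blast
qed (use assms in simp)

lemma satisfies_reachable_cluster:
  assumes "closed_under_permutation F" "closed_under_composition F" and f: "f \<in> F"
  shows "satisfies f (m, reachable_cluster F m M)"
proof (rule satisfiesI)
  fix K N
  assume K: "length K = fst f" and \<Phi>: "mset K + mset N \<in> reachable_cluster F m M"
  let ?c = "apply_rows m (snd f) K"
  obtain D where D: "image_mset fst D = mset K + mset N"
      "\<forall>(c, L) \<in># D. reachable F m L c" "(\<Sum>p\<in>#D. mset (snd p)) \<subseteq># mset M"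
    using \<Phi> by (auto simp: reachable_cluster_def)
  obtain ds D' where ds: "D = mset ds + D'" "map fst ds = K" "image_mset fst D' = mset N"
    using image_mset_eq_mset_plusE D(1) by metis
  \<comment> \<open>The pairs over \<open>K\<close> are merged into the single pair
    \<open>(?c, ?L)\<close>, whose part is the sum of theirs, so the total taken from
    \<open>M\<close> is unchanged.\<close>
  let ?L = "concat (map snd ds)"
  have "reachable F m K ?c"
    using f K by (auto simp: reachable_def)
  then have "reachable F m (map fst ds @ []) ?c"
    by (simp add: ds(2))
  then have "reachable F m ([] @ ?L) ?c"
    by (rule reachable_compose[OF assms(1,2)]) (use ds D(2) in auto)
  moreover have "mset ?L = (\<Sum>p\<in>#mset ds. mset (snd p))"
    by (induction ds) auto
  ultimately have "\<forall>(c, L) \<in># add_mset (?c, ?L) D'. reachable F m L c"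
      "(\<Sum>p\<in>#add_mset (?c, ?L) D'. mset (snd p)) \<subseteq># mset M"
    using D(2,3) by (auto simp: ds(1))
  moreover have "add_mset ?c (mset N) = image_mset fst (add_mset (?c, ?L) D')"
    by (simp add: ds(3))
  ultimately show "add_mset ?c (mset N) \<in> reachable_cluster F m M"
    unfolding reachable_cluster_def by blast
qed

text \<open>Every column uses up just itself, through the unary projection.\<close>

lemma mset_in_reachable_cluster:
  assumes "contains_projections F" "set M \<subseteq> tuples m"
  shows "mset M \<in> reachable_cluster F m M"
proof -
  let ?D = "image_mset (\<lambda>c. (c, [c])) (mset M)"
  have "mset M = image_mset fst ?D"
    by (simp add: image_mset.compositionality comp_def)
  moreover have "\<forall>(c, L) \<in># ?D. reachable F m L c"
    using assms by (auto simp: tuples_def intro!: reachable_singleton)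
  moreover have "(\<Sum>p\<in>#?D. mset (snd p)) \<subseteq># mset M"
    by (simp add: image_mset.compositionality comp_def)
  ultimately show ?thesis
    unfolding reachable_cluster_def by blast
qed

text \<open>The part used by \<open>c\<close> may be smaller than \<open>M\<close>; monotonicity
  adds the missing columns, so that the operation found has one argument for each column of
  \<open>M\<close>.\<close>

lemma singleton_in_reachable_cluster:
  assumes "closed_under_permutation F" "closed_under_dummies F"
    and "{#c#} \<in> reachable_cluster F m M"
  shows "reachable F m M c"
proof -
  obtain D where D: "image_mset fst D = {#c#}" "\<forall>(c, L) \<in># D. reachable F m L c"
      "(\<Sum>p\<in>#D. mset (snd p)) \<subseteq># mset M"
    using assms(3) by (auto simp: reachable_cluster_def)
  obtain L where "D = {#(c, L)#}"
    using D(1) msed_map_invR[of fst D c "{#}"] by auto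
  then show ?thesis
    using D(2,3) reachable_mset_mono[OF assms(1,2), of m L c M] by simp
qed

section \<open>Separation by clusters and the equivalence\<close>

lemma separating_cluster:
  assumes "locally_closed F" "contains_projections F" "closed_under_permutation F"
    "closed_under_dummies F" "closed_under_composition F"
    and g: "g \<in> operations" "g \<notin> F"
  obtains \<Phi> where "\<Phi> \<in> clusters" "\<forall>f\<in>F. satisfies f \<Phi>" "\<not> satisfies g \<Phi>"
proof -
  obtain n h where nh: "g = (n, h)" "1 \<le> n"
    using g(1) by (auto simp: operations_def)
  have "\<not> (\<forall>X. finite X \<and> X \<subseteq> tuples n \<longrightarrow> (\<exists>f. (n, f) \<in> F \<and> (\<forall>x\<in>X. h x = f x)))"
    using assms(1) g unfolding locally_closed_def nh(1) by blast
  then obtain X where X: "finite X" "X \<subseteq> tuples n"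
      "\<nexists>f. (n, f) \<in> F \<and> (\<forall>x\<in>X. h x = f x)"
    by blast
  obtain rs where rs: "set rs = X"
    using finite_list[OF X(1)] by blast
  \<comment> \<open>\<open>M\<close> is the transpose of \<open>rs\<close>: its rows are the tuples
    in \<open>X\<close>. Repetitions in \<open>rs\<close> merely repeat rows.\<close>
  define m where "m = length rs"
  define M where "M = map (\<lambda>j. map (\<lambda>r. r ! j) rs) [0..<n]"
  have M: "length M = n" "set M \<subseteq> tuples m"
    by (auto simp: M_def m_def tuples_def)
  have row: "map (\<lambda>a. a ! i) M = rs ! i" if "i < m" for i
  proof -
    have "length (rs ! i) = n"
      using that X(2) rs nth_mem[of i rs] by (auto simp: m_def tuples_def)
    then show ?thesis
      using that by (intro nth_equalityI) (simp_all add: M_def m_def)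
  qed
  let ?\<Phi> = "(m, reachable_cluster F m M)"
  \<comment> \<open>On an empty \<open>X\<close> any \<open>n\<close>-ary member of
    \<open>F\<close>, such as a projection, would agree with \<open>h\<close>. Hence
    \<open>m\<close> is positive, as a cluster requires.\<close>
  have "proj n 0 \<in> F"
    using assms(2) nh(2) by (simp add: contains_projections_def)
  then have "X \<noteq> {}"
    using X(3) unfolding proj_def by blast
  then have "1 \<le> m"
    using rs by (cases rs) (auto simp: m_def)
  then have "?\<Phi> \<in> clusters"
    by (rule reachable_cluster_cluster)
  moreover have "\<forall>f\<in>F. satisfies f ?\<Phi>"
    using satisfies_reachable_cluster[OF assms(3,5)] by blast
  moreover have "\<not> satisfies g ?\<Phi>"
  proof
    assume "satisfies g ?\<Phi>"
    \<comment> \<open>With an empty second matrix, the column \<open>gM\<close> remains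
      alone.\<close>
    then have "add_mset (apply_rows m (snd g) M) (mset []) \<in> reachable_cluster F m M"
      by (rule satisfiesD) (use M mset_in_reachable_cluster[OF assms(2) M(2)] in \<open>simp_all add: nh(1)\<close>)
    then have "reachable F m M (apply_rows m h M)"
      using singleton_in_reachable_cluster[OF assms(3,4)] by (simp add: nh(1))
    then obtain f where f: "(n, f) \<in> F" "apply_rows m f M = apply_rows m h M"
      by (auto simp: reachable_def M(1))
    have "h x = f x" if x: "x \<in> X" for x
    proof -
      obtain i where "i < m" "x = rs ! i"
        using x rs by (auto simp: in_set_conv_nth m_def)
      then show ?thesis
        using arg_cong[OF f(2), of "\<lambda>c. c ! i"] row by simp
    qed
    then show False
      using X(3) f(1) by blast
  qed
  ultimately show thesis
    by (rule that)
qed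

theorem theorem5p1:
  fixes F :: "'a oper set"
  assumes "F \<subseteq> operations"
  shows "(locally_closed F \<and> contains_projections F \<and> closed_under_permutation F \<and>
          closed_under_dummies F \<and> closed_under_composition F) \<longleftrightarrow>
         (\<exists>\<T>. \<T> \<subseteq> clusters \<and> characterized_by F \<T>)"
proof (intro iffI)
  assume F: "locally_closed F \<and> contains_projections F \<and> closed_under_permutation F \<and>
    closed_under_dummies F \<and> closed_under_composition F"
  \<comment> \<open>The largest candidate: members of \<open>F\<close> satisfy it by choice, and
    separation excludes all other operations.\<close>
  let ?\<T> = "{\<Phi> \<in> clusters. \<forall>f\<in>F. satisfies f \<Phi>}"
  have "g \<in> F" if "g \<in> operations" "\<forall>\<Phi>\<in>?\<T>. satisfies g \<Phi>" for g
    using separating_cluster[of F g] F that by blast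
  then have "characterized_by F ?\<T>"
    unfolding characterized_by_def using assms by blast
  moreover have "?\<T> \<subseteq> clusters"
    by blast
  ultimately show "\<exists>\<T>. \<T> \<subseteq> clusters \<and> characterized_by F \<T>"
    by (intro exI conjI)
next
  assume "\<exists>\<T>. \<T> \<subseteq> clusters \<and> characterized_by F \<T>"
  then obtain \<T> where "\<T> \<subseteq> clusters" "characterized_by F \<T>"
    by blast
  then show "locally_closed F \<and> contains_projections F \<and> closed_under_permutation F \<and>
      closed_under_dummies F \<and> closed_under_composition F"
    using characterized_imp_closed[of \<T> F] by simp
qed

end
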